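(* Let $A\in\mathbb{R}^{n\times n}$ be entrywise nonnegative and irreducible, with $A\mathbf{1}>\mathbf{0}$, and let $D=\operatorname{diag}(A\mathbf{1})$. Let $\mathbf{t}\in\mathbb{R}^n$ with $\mathbf{t}\ge\mathbf{0}$ and $\mathbf{t}^{\top}\mathbf{1}=1$, let $\alpha\in(0,1)$, and let $\widehat{\boldsymbol{\pi}}\in\mathbb{R}^n$ with $\widehat{\boldsymbol{\pi}}>\mathbf{0}$ and $\widehat{\boldsymbol{\pi}}^{\top}\mathbf{1}=1$. Then the set of matrices $\Delta\in\mathbb{S}(A+I)$ satisfying all of the following conditions is non-empty: 1. $\Delta\mathbf{1}=\mathbf{0}$; 2. the off-diagonal entries of $A+\Delta$ are nonnegative; 3. $\widetilde{G}^{\top}\widehat{\boldsymbol{\pi}}=\widehat{\boldsymbol{\pi}}$, where $\widetilde{G}=\alpha D^{-1}(A+\Delta)+(1-\alpha)\mathbf{1}\mathbf{t}^{\top}$.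
   Context: Here $\mathbf{1}$ is the all-ones vector in $\mathbb{R}^n$, vector and matrix inequalities are entrywise, and $\operatorname{diag}(\mathbf{x})$ is the diagonal matrix with diagonal $\mathbf{x}$. For a matrix $M\in\mathbb{R}^{n\times n}$, $\mathbb{S}(M)$ is the set of matrices $B\in\mathbb{R}^{n\times n}$ such that $[B]_{i,j}\neq 0$ implies $[M]_{i,j}\ne 0$. Irreducible means that the directed graph with an edge from $i$ to $j$ whenever $[A]_{i,j}\ne0$ is strongly connected. *)

theory Defs
  imports "HOL-Analysis.Analysis" "Graph_Theory.Digraph_Component"
begin

definition diag :: "real ^ 'n \<Rightarrow> real ^ 'n ^ 'n" where
  "diag x = (\<chi> i j. if i = j then x $ i else 0)"

definition outer_product :: "real ^ 'n \<Rightarrow> real ^ 'n \<Rightarrow> real ^ 'n ^ 'n" where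
  "outer_product x y = (\<chi> i j. x $ i * y $ j)"

definition pattern_set :: "real ^ 'n ^ 'n \<Rightarrow> (real ^ 'n ^ 'n) set" where
  "pattern_set M = {B. \<forall>i j. B $ i $ j \<noteq> 0 \<longrightarrow> M $ i $ j \<noteq> 0}"

definition matrix_digraph :: "real ^ 'n ^ 'n \<Rightarrow> ('n, 'n \<times> 'n) pre_digraph" where
  "matrix_digraph A = \<lparr>verts = UNIV, arcs = {(i, j). A $ i $ j \<noteq> 0}, tail = fst, head = snd\<rparr>"

definition irreducible_matrix :: "real ^ 'n ^ 'n \<Rightarrow> bool" where
  "irreducible_matrix A \<longleftrightarrow> strongly_connected (matrix_digraph A)"

(* The order < on real ^ 'n is (\<le>) together with (\<noteq>), so it is not the entrywise
   strict order; entrywise strict inequalities are therefore written out.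
   The constant 1 :: real ^ 'n is the all-ones vector, while the identity matrix is mat 1. *)

end

theory Submission
  imports Defs
begin

text \<open>
  Put Y = diag(\<pi>) D^{-1} (A + \<Delta>). The conditions say that Y has nonnegative off-diagonal entries
  on the pattern of A, row sums \<pi>, and column sums b = (\<pi> - (1 - \<alpha>) t) / \<alpha>. As the diagonal of
  Y has no sign constraint, this only asks for a nonnegative flow on the digraph of A with net
  outflow \<pi> - b at each vertex. The entries of \<pi> - b sum to zero, and strong connectivity allows
  every such demand to be routed along paths through a fixed vertex.
\<close>

text \<open>This is the divergence of the flow \<open>F\<close>, with \<open>F $ i $ j\<close> the
  amount sent from \<open>i\<close> to \<open>j\<close>. Loops cancel, so diagonal entries can be
  changed freely without affecting it.\<close>

definition net_outflow :: "real ^ 'n ^ 'n \<Rightarrow> real ^ 'n" where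
  "net_outflow F = F *v 1 - 1 v* F"

lemma net_outflow_nth: "net_outflow F $ i = (\<Sum>j\<in>UNIV. F $ i $ j) - (\<Sum>j\<in>UNIV. F $ j $ i)"
  by (simp add: net_outflow_def matrix_vector_mult_def vector_matrix_mult_def)

lemma linear_net_outflow: "linear net_outflow"
  by (rule linearI) (simp_all add: vec_eq_iff net_outflow_nth sum.distrib sum_distrib_left algebra_simps)

lemma net_outflow_elementary:
  fixes u v :: "'n :: finite"
  shows "net_outflow (outer_product (axis u 1) (axis v 1)) = axis u 1 - axis v 1"
proof -
  have "(\<Sum>j\<in>UNIV. axis k (1::real) $ j) = 1" for k :: 'n
    by (simp add: axis_def)
  then show ?thesis
    by (simp add: vec_eq_iff net_outflow_nth outer_product_def
        flip: sum_distrib_left sum_distrib_right)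
qed

lemma pattern_set_sum:
  assumes "\<And>k. k \<in> K \<Longrightarrow> F k \<in> pattern_set M"
  shows "(\<Sum>k\<in>K. F k) \<in> pattern_set M"
proof -
  have "(\<Sum>k\<in>K. F k $ i $ j) = 0" if "M $ i $ j = 0" for i j
    using assms that by (intro sum.neutral) (auto simp: pattern_set_def)
  then show ?thesis
    by (auto simp: pattern_set_def)
qed

text \<open>One unit is sent along a walk: each arc contributes an elementary matrix, and the net
  outflows telescope. An arc used repeatedly just accumulates flow.\<close>

lemma reachable_imp_unit_flow:
  assumes "u \<rightarrow>\<^sup>*\<^bsub>matrix_digraph A\<^esub> v"
  obtains F where "F \<in> pattern_set A" "\<forall>i j. 0 \<le> F $ i $ j"
    "net_outflow F = axis u 1 - axis v 1"
proof -
  have "\<exists>F\<in>pattern_set A. (\<forall>i j. 0 \<le> F $ i $ j) \<and> net_outflow F = axis u 1 - axis v 1"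
    using assms unfolding reachable_def
  proof (induction rule: rtrancl_on_induct)
    case base
    show ?case
      by (rule bexI[of _ 0]) (auto simp: pattern_set_def linear_0[OF linear_net_outflow])
  next
    case (step w v)
    then obtain F where F: "F \<in> pattern_set A" "\<forall>i j. 0 \<le> F $ i $ j"
      "net_outflow F = axis u 1 - axis w 1"
      by auto
    let ?E = "outer_product (axis w 1) (axis v 1)"
    have "A $ w $ v \<noteq> 0"
      using step by (auto simp: matrix_digraph_def arcs_ends_def arc_to_ends_def)
    then have "F + ?E \<in> pattern_set A"
      using F(1) by (auto simp: pattern_set_def outer_product_def axis_def split: if_splits)
    moreover have "\<forall>i j. 0 \<le> (F + ?E) $ i $ j"
      using F(2) by (auto simp: outer_product_def axis_def)
    moreover have "net_outflow (F + ?E) = axis u 1 - axis v 1"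
      by (simp add: linear_add[OF linear_net_outflow] F(3) net_outflow_elementary)
    ultimately show ?case by blast
  qed
  then show thesis using that by blast
qed

text \<open>Every surplus is sent to one hub and every deficit is supplied from it. The hub balances
  because the demands sum to zero.\<close>

lemma irreducible_imp_flow:
  fixes s :: "real ^ 'n"
  assumes "irreducible_matrix A" and "s \<bullet> 1 = 0"
  obtains F where "F \<in> pattern_set A" "\<forall>i j. 0 \<le> F $ i $ j" "net_outflow F = s"
proof -
  have "\<exists>F. F \<in> pattern_set A \<and> (\<forall>i j. 0 \<le> F $ i $ j) \<and> net_outflow F = axis u 1 - axis v 1" for u v
  proof -
    have "u \<rightarrow>\<^sup>*\<^bsub>matrix_digraph A\<^esub> v"
      using assms(1) by (auto simp: irreducible_matrix_def strongly_connected_def matrix_digraph_def)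
    then show ?thesis by (rule reachable_imp_unit_flow) blast
  qed
  then obtain P where P: "\<And>u v. P u v \<in> pattern_set A" "\<And>u v i j. 0 \<le> P u v $ i $ j"
    "\<And>u v. net_outflow (P u v) = axis u 1 - axis v 1"
    by metis
  fix r :: 'n
  \<comment> \<open>The hub \<open>r\<close> is arbitrary. Taking positive and negative parts of
    \<open>s $ u\<close> keeps both coefficients nonnegative, and their difference is
    \<open>s $ u\<close>.\<close>
  define F where
    "F = (\<Sum>u\<in>UNIV. max (s $ u) 0 *\<^sub>R P u r + max (- s $ u) 0 *\<^sub>R P r u)"
  show thesis
  proof
    show "F \<in> pattern_set A"
      unfolding F_def using P(1) by (intro pattern_set_sum) (simp add: pattern_set_def, metis add_0 mult_zero_right)
    show "\<forall>i j. 0 \<le> F $ i $ j"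
      unfolding F_def by (auto simp: P(2) intro!: sum_nonneg add_nonneg_nonneg mult_nonneg_nonneg)
    have "net_outflow F = (\<Sum>u\<in>UNIV. s $ u *\<^sub>R (axis u 1 - axis r 1))"
      unfolding F_def
      by (auto simp: linear_sum[OF linear_net_outflow] linear_add[OF linear_net_outflow]
          linear_scale[OF linear_net_outflow] P(3) max_def algebra_simps intro!: sum.cong)
    also have "\<dots> = s - (\<Sum>u\<in>UNIV. s $ u) *\<^sub>R axis r 1"
      by (simp add: vec_eq_iff axis_def sum_subtractf right_diff_distrib sum_distrib_right
          if_distrib[of "(*) _"] cong: if_cong)
    also have "\<dots> = s"
      using assms(2) by (simp add: inner_vec_def)
    finally show "net_outflow F = s" .
  qed
qed

lemma diag_nth: "diag x $ i $ j = (if i = j then x $ i else 0)"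
  by (simp add: diag_def)

lemma diag_mult_nth: "(diag x ** M) $ i $ j = x $ i * M $ i $ j"
  by (simp add: matrix_matrix_mult_def diag_def if_distrib if_distribR cong: if_cong)

text \<open>\<open>matrix_inv\<close> is defined by choice, so besides exhibiting a two-sided
  inverse one has to show that it is unique.\<close>

lemma matrix_inv_diag:
  assumes "\<forall>i. x $ i \<noteq> 0"
  shows "matrix_inv (diag x) = diag (\<chi> i. 1 / x $ i)"
proof -
  let ?y = "\<chi> i. 1 / x $ i"
  have inverse: "diag x ** diag ?y = mat 1" "diag ?y ** diag x = mat 1"
    using assms by (auto simp: vec_eq_iff diag_mult_nth diag_nth mat_def)
  show ?thesis
    unfolding matrix_inv_def
  proof (rule some_equality)
    fix B assume B: "diag x ** B = mat 1 \<and> B ** diag x = mat 1"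
    have "B = (diag ?y ** diag x) ** B"
      by (simp add: inverse)
    also have "\<dots> = diag ?y"
      using B by (simp flip: matrix_mul_assoc)
    finally show "B = diag ?y" .
  qed (simp add: inverse)
qed

theorem proposition4p1:
  fixes A D :: "real ^ 'n ^ 'n"
    and t \<pi> :: "real ^ 'n"
    and \<alpha> :: real
  assumes "\<forall>i j. 0 \<le> A $ i $ j"
    and "irreducible_matrix A"
    and "\<forall>i. 0 < (A *v 1) $ i"
    and "D = diag (A *v 1)"
    and "\<forall>i. 0 \<le> t $ i"
    and "t \<bullet> 1 = 1"
    and "0 < \<alpha>" and "\<alpha> < 1"
    and "\<forall>i. 0 < \<pi> $ i"
    and "\<pi> \<bullet> 1 = 1"
  shows "{\<Delta> \<in> pattern_set (A + mat 1).
            \<Delta> *v 1 = 0 \<and>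
            (\<forall>i j. i \<noteq> j \<longrightarrow> 0 \<le> (A + \<Delta>) $ i $ j) \<and>
            (let G = \<alpha> *\<^sub>R (matrix_inv D ** (A + \<Delta>))
                     + (1 - \<alpha>) *\<^sub>R outer_product 1 t
             in transpose G *v \<pi> = \<pi>)} \<noteq> {}"
proof -
  define d where "d = A *v 1"
  \<comment> \<open>Prescribed row sums minus prescribed column sums of \<open>Y\<close>. Both
    vectors have total 1, which makes the demand \<open>s\<close> balanced.\<close>
  define s where "s = \<pi> - (1 / \<alpha>) *\<^sub>R (\<pi> - (1 - \<alpha>) *\<^sub>R t)"
  have d_pos: "0 < d $ i" for i
    using assms(3) by (simp add: d_def)
  have \<pi>_pos: "0 < \<pi> $ i" for i
    using assms(9) by blast
  have \<pi>_nz: "\<pi> $ i \<noteq> 0" for i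
    using \<pi>_pos[of i] by simp
  have sum_\<pi>: "(\<Sum>i\<in>UNIV. \<pi> $ i) = 1"
    using assms(10) by (simp add: inner_vec_def)
  have "s \<bullet> 1 = 0"
    using assms(6,7,10) by (simp add: s_def inner_diff_left)
  then obtain F where F: "F \<in> pattern_set A" "\<forall>i j. 0 \<le> F $ i $ j" "net_outflow F = s"
    using irreducible_imp_flow[OF assms(2)] by blast
  \<comment> \<open>The diagonal term corrects the row sums to \<open>\<pi>\<close>. It leaves the
    net outflow at \<open>s\<close>, so the column sums become \<open>\<pi> - s\<close>, as
    required.\<close>
  define Y where "Y = F + diag (\<pi> - F *v 1)"
  \<comment> \<open>This solves \<open>Y = diag \<pi> ** matrix_inv D ** (A + \<Delta>)\<close> for
    \<open>\<Delta>\<close>.\<close>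
  define \<Delta> where "\<Delta> = (\<chi> i j. d $ i / \<pi> $ i * Y $ i $ j) - A"
  have row: "(\<Sum>j\<in>UNIV. Y $ i $ j) = \<pi> $ i" for i
    by (simp add: Y_def diag_def sum.distrib matrix_vector_mult_def)
  have col: "\<alpha> * (\<Sum>j\<in>UNIV. Y $ j $ i) = \<pi> $ i - (1 - \<alpha>) * t $ i" for i
  proof -
    have "(\<Sum>j\<in>UNIV. Y $ j $ i) = \<pi> $ i - net_outflow F $ i"
      by (simp add: Y_def diag_def sum.distrib matrix_vector_mult_def net_outflow_nth)
    then show ?thesis
      using assms(7) by (simp add: F(3) s_def)
  qed
  have "\<Delta> \<in> pattern_set (A + mat 1)"
  proof -
    \<comment> \<open>Nonnegativity of \<open>A\<close> rules out cancellation with the identity, so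
      the whole diagonal lies in the pattern and the correction in \<open>Y\<close> is
      admissible.\<close>
    have "0 < A $ i $ i + 1" for i
      using assms(1) by (simp add: add_nonneg_pos)
    then have "A $ i $ i + 1 \<noteq> 0" for i
      by (metis less_irrefl)
    then show ?thesis
      using F(1) by (auto simp: pattern_set_def \<Delta>_def Y_def diag_def mat_def)
  qed
  moreover have "\<Delta> *v 1 = 0"
  proof -
    have "(\<Sum>j\<in>UNIV. d $ i / \<pi> $ i * Y $ i $ j) = d $ i" for i
      unfolding sum_distrib_left[symmetric] row using \<pi>_nz by simp
    moreover have "(\<Sum>j\<in>UNIV. A $ i $ j) = d $ i" for i
      by (simp add: d_def matrix_vector_mult_def)
    ultimately show ?thesis
      by (simp add: vec_eq_iff matrix_vector_mult_def \<Delta>_def sum_subtractf)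
  qed
  moreover have "\<forall>i j. i \<noteq> j \<longrightarrow> 0 \<le> (A + \<Delta>) $ i $ j"
    using F(2) d_pos \<pi>_pos by (auto simp: \<Delta>_def Y_def diag_def less_imp_le)
  moreover have "transpose (\<alpha> *\<^sub>R (matrix_inv D ** (A + \<Delta>)) + (1 - \<alpha>) *\<^sub>R outer_product 1 t) *v \<pi> = \<pi>"
    (is "transpose ?G *v \<pi> = \<pi>")
  proof -
    have "matrix_inv D = diag (\<chi> i. 1 / d $ i)"
      using d_pos by (simp add: assms(4) d_def[symmetric] matrix_inv_diag less_imp_neq[symmetric])
    \<comment> \<open>Weighting row \<open>j\<close> by \<open>\<pi> $ j\<close> undoes the scaling
      \<open>d $ j / \<pi> $ j\<close> together with \<open>matrix_inv D\<close>, leaving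
      \<open>Y\<close>.\<close>
    then have "?G $ j $ i * \<pi> $ j = \<alpha> * Y $ j $ i + (1 - \<alpha>) * t $ i * \<pi> $ j" for i j
      using d_pos[of j] \<pi>_nz[of j]
      by (simp add: diag_mult_nth \<Delta>_def outer_product_def field_simps)
    then have "(transpose ?G *v \<pi>) $ i =
        \<alpha> * (\<Sum>j\<in>UNIV. Y $ j $ i) + (1 - \<alpha>) * t $ i * (\<Sum>j\<in>UNIV. \<pi> $ j)" for i
      by (simp add: matrix_vector_mult_def transpose_def sum.distrib sum_distrib_left)
    then show ?thesis
      by (simp add: vec_eq_iff col sum_\<pi>)
  qed
  ultimately show ?thesis
    unfolding Let_def by blast
qed

end
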